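(* Let $k>1$ and let $J\subseteq C(n,k)$ be a realizable $k$-set. The map sending a path from $\emptyset$ to $J$ in $B(n,k-1)$ (i.e. a total order on $J$ all of whose prefixes are realizable $k$-sets) to the total order it induces on $J$ is a bijection between the set of such paths and the set $A_J(n,k)$ of admissible $J$-orders.
   Context: $C(n,k)$: $k$-element subsets of $\{1,\dots,n\}$ with lexicographic order (increasing sequences compared lexicographically); antilexicographic = reverse. For $X\in C(n,k+1)$, $P_X=\{Y\in C(n,k):Y\subset X\}$ with induced lexicographic order. Prefix/suffix = initial/final segment (possibly empty or all). For $A\subseteq C(n,k)$: $A_p$ (resp. $A_s$) = $\{X\in C(n,k+1): P_X\cap A$ a nonempty prefix (resp. suffix) of $P_X$, $\ne P_X\}$, $A_F=\{X:P_X\subseteq A\}$, $A_\emptyset=\{X:P_X\cap A=\emptyset\}$; $A$ is realizable if each $P_X\cap A$ is a prefix or suffix of $P_X$. By Ziegler's theorem the higher Bruhat order $B(n,k-1)$ is isomorphic to the poset of realizable subsets of $C(n,k)$ under single-step inclusion; accordingly a path from $\emptyset$ to $J$ in $B(n,k-1)$ is a chain $\emptyset=U_0\subset U_1\subset\dots\subset U_m=J$ of realizable subsets of $C(n,k)$ with $|U_j\setminus U_{j-1}|=1$, identified with the total order on $J$ in which elements are listed in the order they are added. An admissible $J$-order is a total order on $J$ inducing the antilexicographic order on $P_X\cap J$ for $X\in J_s$, the lexicographic order on $P_X\cap J$ for $X\in J_p$, and the lexicographic or antilexicographic order on $P_X$ for $X\in J_F$. *)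

theory Defs
  imports Main
begin

definition ksubsets :: "nat \<Rightarrow> nat \<Rightarrow> nat set set" where
  "ksubsets n k = {A. A \<subseteq> {1..n} \<and> card A = k}"

(* Only meaningful on finite sets, since sorted_list_of_set maps every infinite set
   to the empty list; below it is always restricted to subsets of ksubsets n k. *)
definition lex_order :: "nat set rel" where
  "lex_order = {(A, B). A = B \<or>
     (sorted_list_of_set A, sorted_list_of_set B) \<in> lexord less_than}"

abbreviation antilex_order :: "nat set rel" where
  "antilex_order \<equiv> lex_order\<inverse>"

definition packet :: "nat \<Rightarrow> nat \<Rightarrow> nat set \<Rightarrow> nat set set" where
  "packet n k X = {Y \<in> ksubsets n k. Y \<subset> X}"

definition lex_prefix :: "nat set set \<Rightarrow> nat set set \<Rightarrow> bool" where
  "lex_prefix S P \<longleftrightarrow> S \<subseteq> P \<and> (\<forall>B\<in>S. \<forall>A\<in>P. (A, B) \<in> lex_order \<longrightarrow> A \<in> S)"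

definition lex_suffix :: "nat set set \<Rightarrow> nat set set \<Rightarrow> bool" where
  "lex_suffix S P \<longleftrightarrow> S \<subseteq> P \<and> (\<forall>A\<in>S. \<forall>B\<in>P. (A, B) \<in> lex_order \<longrightarrow> B \<in> S)"

definition prefix_part :: "nat \<Rightarrow> nat \<Rightarrow> nat set set \<Rightarrow> nat set set" where
  "prefix_part n k A = {X \<in> ksubsets n (k + 1).
     packet n k X \<inter> A \<noteq> {} \<and> packet n k X \<inter> A \<noteq> packet n k X \<and>
     lex_prefix (packet n k X \<inter> A) (packet n k X)}"

definition suffix_part :: "nat \<Rightarrow> nat \<Rightarrow> nat set set \<Rightarrow> nat set set" where
  "suffix_part n k A = {X \<in> ksubsets n (k + 1).
     packet n k X \<inter> A \<noteq> {} \<and> packet n k X \<inter> A \<noteq> packet n k X \<and>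
     lex_suffix (packet n k X \<inter> A) (packet n k X)}"

definition full_part :: "nat \<Rightarrow> nat \<Rightarrow> nat set set \<Rightarrow> nat set set" where
  "full_part n k A = {X \<in> ksubsets n (k + 1). packet n k X \<subseteq> A}"

definition realizable :: "nat \<Rightarrow> nat \<Rightarrow> nat set set \<Rightarrow> bool" where
  "realizable n k A \<longleftrightarrow> A \<subseteq> ksubsets n k \<and>
     (\<forall>X \<in> ksubsets n (k + 1).
        lex_prefix (packet n k X \<inter> A) (packet n k X) \<or>
        lex_suffix (packet n k X \<inter> A) (packet n k X))"

(* Paths from the empty set to J in the higher Bruhat order B(n, k - 1), in Ziegler's model:
   the elements of B(n, k - 1) are the realizable subsets of ksubsets n k,
   ordered by single-step inclusion. *)
definition bruhat_paths :: "nat \<Rightarrow> nat \<Rightarrow> nat set set \<Rightarrow> nat set set list set" where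
  "bruhat_paths n k J = {Us. Us \<noteq> [] \<and> hd Us = {} \<and> last Us = J \<and>
     (\<forall>U \<in> set Us. realizable n k U) \<and>
     successively (\<lambda>U V. U \<subset> V \<and> card (V - U) = 1) Us}"

definition entry_step :: "'a set list \<Rightarrow> 'a \<Rightarrow> nat" where
  "entry_step Us x = (LEAST j. j < length Us \<and> x \<in> Us ! j)"

definition path_order :: "'a set list \<Rightarrow> 'a rel" where
  "path_order Us = {(x, y). x \<in> last Us \<and> y \<in> last Us \<and> entry_step Us x \<le> entry_step Us y}"

(* Total orders are reflexive relations; r "induces" s on S iff Restr r S = Restr s S. *)
definition admissible_orders :: "nat \<Rightarrow> nat \<Rightarrow> nat set set \<Rightarrow> nat set rel set" where
  "admissible_orders n k J = {r. linear_order_on J r \<and>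
     (\<forall>X \<in> suffix_part n k J.
        Restr r (packet n k X \<inter> J) = Restr antilex_order (packet n k X \<inter> J)) \<and>
     (\<forall>X \<in> prefix_part n k J.
        Restr r (packet n k X \<inter> J) = Restr lex_order (packet n k X \<inter> J)) \<and>
     (\<forall>X \<in> full_part n k J.
        Restr r (packet n k X) = Restr lex_order (packet n k X) \<or>
        Restr r (packet n k X) = Restr antilex_order (packet n k X))}"

end

theory Submission
  imports Defs
begin

text \<open>A chain from the empty set to \<open>J\<close> adding one element at a time is recovered from its total
  order: its \<open>j\<close>-th member consists of the elements of rank at most \<open>j\<close>. It remains to see that all
  initial segments of a total order are realizable iff the order is admissible, which is checked
  on each packet \<open>P\<close> separately. If \<open>J\<close> meets \<open>P\<close> in a proper nonempty prefix, then so does every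
  realizable subset of \<open>J\<close> that meets \<open>P\<close>, because a nonempty suffix of \<open>P\<close> is not contained in
  \<open>J\<close>. If \<open>P\<close> lies in \<open>J\<close>, the first element of \<open>P\<close> to enter is an end of \<open>P\<close>, and it forces every
  later intersection to be a segment starting at that same end.\<close>

text \<open>The relation \<open>L\<close> is a parameter so that prefixes and suffixes become one
  notion, for \<open>lex_order\<close> and its converse; each packet argument is then given
  once.\<close>

definition initial_in :: "'a rel \<Rightarrow> 'a set \<Rightarrow> 'a set \<Rightarrow> bool" where
  "initial_in L S P \<longleftrightarrow> S \<subseteq> P \<and> (\<forall>b\<in>S. \<forall>a\<in>P. (a, b) \<in> L \<longrightarrow> a \<in> S)"

definition connex_on :: "'a set \<Rightarrow> 'a rel \<Rightarrow> bool" where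
  "connex_on P L \<longleftrightarrow> (\<forall>x\<in>P. \<forall>y\<in>P. (x, y) \<in> L \<or> (y, x) \<in> L)"

text \<open>For a reflexive \<open>r\<close> the element itself is counted, so ranks on
  \<open>J\<close> start at 1 and agree with entry steps of chains that start from the empty
  set.\<close>

definition rank :: "'a rel \<Rightarrow> 'a \<Rightarrow> nat" where
  "rank r x = card {y. (y, x) \<in> r}"

definition chain_of :: "'a set \<Rightarrow> 'a rel \<Rightarrow> 'a set list" where
  "chain_of J r = map (\<lambda>j. {x \<in> J. rank r x \<le> j}) [0..<Suc (card J)]"

text \<open>This is \<open>bruhat_paths\<close> with realizability left out: chains and orders are
  matched on an arbitrary set first.\<close>

definition unit_chain :: "'a set \<Rightarrow> 'a set list \<Rightarrow> bool" where
  "unit_chain J Us \<longleftrightarrow> Us \<noteq> [] \<and> hd Us = {} \<and> last Us = J \<and>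
     successively (\<lambda>U V. U \<subset> V \<and> card (V - U) = 1) Us"

section \<open>Prefixes, suffixes and the lexicographic order on packets\<close>

lemma lex_prefix_iff_initial_in: "lex_prefix S P \<longleftrightarrow> initial_in lex_order S P"
  by (simp add: lex_prefix_def initial_in_def)

lemma lex_suffix_iff_initial_in: "lex_suffix S P \<longleftrightarrow> initial_in antilex_order S P"
  by (simp add: lex_suffix_def initial_in_def)

lemma connex_on_converse [simp]: "connex_on P (L\<inverse>) \<longleftrightarrow> connex_on P L"
  by (auto simp: connex_on_def)

lemma connex_on_subset: "connex_on P L \<Longrightarrow> Q \<subseteq> P \<Longrightarrow> connex_on Q L"
  by (auto simp: connex_on_def)

lemma lex_order_connex_on:
  assumes "\<And>A. A \<in> P \<Longrightarrow> finite A"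
  shows "connex_on P lex_order"
  unfolding connex_on_def
proof (intro ballI)
  fix A B assume AB: "A \<in> P" "B \<in> P"
  have "(sorted_list_of_set A, sorted_list_of_set B) \<in> lexord less_than \<or>
      sorted_list_of_set A = sorted_list_of_set B \<or>
      (sorted_list_of_set B, sorted_list_of_set A) \<in> lexord less_than"
    by (rule lexord_linear) auto
  \<comment> \<open>Finiteness enters here: a finite set is recovered from its sorted list.\<close>
  moreover have "A = B" if "sorted_list_of_set A = sorted_list_of_set B"
    using that assms AB by (metis sorted_list_of_set(1))
  ultimately show "(A, B) \<in> lex_order \<or> (B, A) \<in> lex_order"
    by (auto simp: lex_order_def)
qed

lemma packet_lex_connex_on: "connex_on (packet n k X) lex_order"
  by (rule lex_order_connex_on) (auto simp: packet_def ksubsets_def intro: finite_subset)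

lemma finite_ksubsets: "finite (ksubsets n k)"
  by (rule finite_subset[of _ "Pow {1..n}"]) (auto simp: ksubsets_def)

section \<open>From a linear order to a chain, by ranks\<close>

lemma linear_order_on_facts:
  assumes "linear_order_on J r"
  shows "(x, y) \<in> r \<Longrightarrow> x \<in> J" "(x, y) \<in> r \<Longrightarrow> y \<in> J"
    and "x \<in> J \<Longrightarrow> (x, x) \<in> r"
    and "(x, y) \<in> r \<Longrightarrow> (y, z) \<in> r \<Longrightarrow> (x, z) \<in> r"
    and "(x, y) \<in> r \<Longrightarrow> (y, x) \<in> r \<Longrightarrow> x = y"
    and "x \<in> J \<Longrightarrow> y \<in> J \<Longrightarrow> (x, y) \<in> r \<or> (y, x) \<in> r"
proof -
  have r: "r \<subseteq> J \<times> J" "refl_on J r" "trans r" "antisym r" "total_on J r"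
    using assms by (auto simp: order_on_defs)
  show "(x, y) \<in> r \<Longrightarrow> x \<in> J" "(x, y) \<in> r \<Longrightarrow> y \<in> J" using r(1) by auto
  show refl: "x \<in> J \<Longrightarrow> (x, x) \<in> r" using r(2) by (rule refl_onD)
  show "(x, y) \<in> r \<Longrightarrow> (y, z) \<in> r \<Longrightarrow> (x, z) \<in> r" using r(3) by (rule transD)
  show "(x, y) \<in> r \<Longrightarrow> (y, x) \<in> r \<Longrightarrow> x = y" using r(4) by (rule antisymD)
  show "x \<in> J \<Longrightarrow> y \<in> J \<Longrightarrow> (x, y) \<in> r \<or> (y, x) \<in> r"
    using r(5) refl by (cases "x = y") (auto simp: total_on_def)
qed

text \<open>By transitivity, down-sets are nested along \<open>r\<close>. If \<open>x\<close> is not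
  below \<open>y\<close>, then by totality the down-set of \<open>y\<close> is strictly inside that
  of \<open>x\<close>, since it misses \<open>x\<close> itself.\<close>

lemma rank_le_iff:
  assumes "finite J" "linear_order_on J r" "x \<in> J" "y \<in> J"
  shows "rank r x \<le> rank r y \<longleftrightarrow> (x, y) \<in> r"
proof
  note lo = linear_order_on_facts[OF assms(2)]
  have fin: "finite {z. (z, w) \<in> r}" for w
    by (rule finite_subset[OF _ assms(1)]) (auto dest: lo(1))
  show "rank r x \<le> rank r y" if "(x, y) \<in> r"
    unfolding rank_def by (rule card_mono[OF fin]) (use that lo(4) in blast)
  show "(x, y) \<in> r" if "rank r x \<le> rank r y"
  proof (rule ccontr)
    assume n: "(x, y) \<notin> r"
    then have "(y, x) \<in> r" using lo(6) assms(3,4) by blast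
    then have "{z. (z, y) \<in> r} \<subset> {z. (z, x) \<in> r}"
      using n lo(3)[OF assms(3)] lo(4) by blast
    then have "rank r y < rank r x"
      unfolding rank_def by (rule psubset_card_mono[OF fin])
    with that show False by simp
  qed
qed

lemma rank_bij_betw:
  assumes "finite J" "linear_order_on J r"
  shows "bij_betw (rank r) J {1..card J}"
proof -
  note lo = linear_order_on_facts[OF assms(2)]
  have inj: "inj_on (rank r) J"
    using rank_le_iff[OF assms] lo(5) by (metis inj_onI order_refl)
  have "rank r x \<in> {1..card J}" if "x \<in> J" for x
  proof -
    have sub: "{y. (y, x) \<in> r} \<subseteq> J" using lo(1) by blast
    have "x \<in> {y. (y, x) \<in> r}" using lo(3)[OF that] by simp
    then have "0 < rank r x"
      unfolding rank_def using finite_subset[OF sub assms(1)] card_gt_0_iff by blast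
    moreover have "rank r x \<le> card J"
      unfolding rank_def by (rule card_mono[OF assms(1) sub])
    ultimately show ?thesis by simp
  qed
  then have "rank r ` J = {1..card J}"
    using card_image[OF inj] by (intro card_subset_eq) auto
  with inj show ?thesis by (simp add: bij_betw_def)
qed

lemma length_chain_of [simp]: "length (chain_of J r) = Suc (card J)"
  by (simp add: chain_of_def)

lemma nth_chain_of [simp]:
  "j \<le> card J \<Longrightarrow> chain_of J r ! j = {x \<in> J. rank r x \<le> j}"
  by (simp add: chain_of_def del: upt_Suc)

lemma last_chain_of:
  assumes "finite J" "linear_order_on J r"
  shows "last (chain_of J r) = J"
proof -
  have "chain_of J r \<noteq> []" by (simp add: chain_of_def)
  then have "last (chain_of J r) = {x \<in> J. rank r x \<le> card J}"
    by (simp add: last_conv_nth)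
  also have "\<dots> = J" using bij_betwE[OF rank_bij_betw[OF assms]] by auto
  finally show ?thesis .
qed

lemma unit_chain_chain_of:
  assumes "finite J" "linear_order_on J r"
  shows "unit_chain J (chain_of J r)"
  unfolding unit_chain_def
proof (intro conjI)
  note bij = rank_bij_betw[OF assms]
  show ne: "chain_of J r \<noteq> []" by (simp add: chain_of_def)
  show "hd (chain_of J r) = {}"
    using bij_betwE[OF bij] by (auto simp: hd_conv_nth ne)
  show "last (chain_of J r) = J" by (rule last_chain_of[OF assms])
  show "successively (\<lambda>U V. U \<subset> V \<and> card (V - U) = 1) (chain_of J r)"
    unfolding successively_conv_nth
  proof (intro allI impI)
    fix j assume "Suc j < length (chain_of J r)"
    then have j: "Suc j \<le> card J" by simp
    \<comment> \<open>The element added in this step is the one of rank \<open>Suc j\<close>: it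
      exists by surjectivity of the rank and is unique by injectivity.\<close>
    then obtain x where x: "x \<in> J" "rank r x = Suc j"
      using bij_betw_imp_surj_on[OF bij] by (metis atLeastAtMost_iff imageE le_add1 plus_1_eq_Suc)
    have "y = x" if "y \<in> J" "rank r y = Suc j" for y
      using bij_betw_imp_inj_on[OF bij] x that by (metis inj_onD)
    then have "{y \<in> J. rank r y = Suc j} = {x}" using x by blast
    moreover have "{y \<in> J. rank r y \<le> Suc j} - {y \<in> J. rank r y \<le> j} = {y \<in> J. rank r y = Suc j}"
      by (simp add: set_eq_iff) linarith
    ultimately have "chain_of J r ! Suc j - chain_of J r ! j = {x}" using j by simp
    moreover have "chain_of J r ! j \<subseteq> chain_of J r ! Suc j" using j by auto
    ultimately show "chain_of J r ! j \<subset> chain_of J r ! Suc j \<and>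
        card (chain_of J r ! Suc j - chain_of J r ! j) = 1"
      by auto
  qed
qed

text \<open>An element enters the chain at the index equal to its rank, so comparing entry steps is
  comparing ranks.\<close>

lemma path_order_chain_of:
  assumes "finite J" "linear_order_on J r"
  shows "path_order (chain_of J r) = r"
proof -
  have step: "entry_step (chain_of J r) x = rank r x" if "x \<in> J" for x
    unfolding entry_step_def
    using bij_betwE[OF rank_bij_betw[OF assms]] that
    by (intro Least_equality) (auto simp: less_Suc_eq_le)
  show ?thesis
    unfolding path_order_def last_chain_of[OF assms]
    using step rank_le_iff[OF assms] linear_order_on_facts(1,2)[OF assms(2)] by auto
qed

section \<open>From a chain to a linear order, by entry steps\<close>

context
  fixes J :: "'a set" and Us :: "'a set list"
  assumes chain: "unit_chain J Us"
begin

lemma unit_chain_step: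
  "Suc j < length Us \<Longrightarrow> Us ! j \<subset> Us ! Suc j \<and> card (Us ! Suc j - Us ! j) = 1"
  using chain by (auto simp: unit_chain_def successively_conv_nth)

lemma unit_chain_nth:
  "j < length Us \<Longrightarrow> finite (Us ! j) \<and> card (Us ! j) = j"
proof (induction j)
  case 0
  then show ?case using chain by (simp add: unit_chain_def hd_conv_nth)
next
  case (Suc j)
  have IH: "finite (Us ! j)" "card (Us ! j) = j" using Suc by auto
  have st: "Us ! j \<subset> Us ! Suc j" "card (Us ! Suc j - Us ! j) = 1"
    using unit_chain_step[OF Suc.prems] by auto
  \<comment> \<open>An infinite set has \<open>card\<close> 0, so a difference of cardinality 1 is
    finite. Finiteness of every member, and so of \<open>J\<close>, follows from the chain
    alone.\<close>
  have fin: "finite (Us ! Suc j - Us ! j)" using st(2) by (metis card.infinite zero_neq_one)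
  have un: "Us ! Suc j = Us ! j \<union> (Us ! Suc j - Us ! j)" using st(1) by blast
  have "card (Us ! j \<union> (Us ! Suc j - Us ! j)) = j + 1"
    using card_Un_disjoint[OF IH(1) fin] IH(2) st(2) by auto
  then show ?case using un IH(1) fin by (metis Suc_eq_plus1 finite_Un)
qed

lemma unit_chain_mono: "i \<le> j \<Longrightarrow> j < length Us \<Longrightarrow> Us ! i \<subseteq> Us ! j"
proof (induction j rule: dec_induct)
  case base
  then show ?case by simp
next
  case (step j)
  then show ?case using unit_chain_step[of j] by auto
qed

lemma unit_chain_last: "Us ! (length Us - 1) = J"
  using chain by (auto simp: unit_chain_def last_conv_nth)

lemma unit_chain_length: "length Us = Suc (card J)"
proof -
  have "0 < length Us" using chain by (auto simp: unit_chain_def)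
  then show ?thesis using unit_chain_nth[of "length Us - 1"] unit_chain_last by simp
qed

lemma entry_step_le_iff:
  assumes "x \<in> J" "j \<le> card J"
  shows "entry_step Us x \<le> j \<longleftrightarrow> x \<in> Us ! j"
proof
  let ?P = "\<lambda>j. j < length Us \<and> x \<in> Us ! j"
  show "entry_step Us x \<le> j" if "x \<in> Us ! j"
    unfolding entry_step_def using that assms by (intro Least_le) (simp add: unit_chain_length)
  \<comment> \<open>The last member contains \<open>x\<close>, so the \<open>LEAST\<close> in
    \<open>entry_step\<close> is attained; monotonicity then carries \<open>x\<close> into all later
    members.\<close>
  have "?P (card J)" using assms(1) unit_chain_last by (simp add: unit_chain_length)
  then have "?P (entry_step Us x)" unfolding entry_step_def by (rule LeastI)
  then show "x \<in> Us ! j" if "entry_step Us x \<le> j"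
    using unit_chain_mono[OF that] assms(2) by (auto simp: unit_chain_length)
qed

lemma entry_step_le_card:
  assumes "x \<in> J"
  shows "entry_step Us x \<le> card J"
proof -
  have "x \<in> Us ! card J" using assms unit_chain_last by (simp add: unit_chain_length)
  then show ?thesis using entry_step_le_iff[OF assms, of "card J"] by simp
qed

lemma unit_chain_subset: "U \<in> set Us \<Longrightarrow> U \<subseteq> J"
proof -
  assume "U \<in> set Us"
  then obtain j where "j < length Us" "U = Us ! j" by (auto simp: in_set_conv_nth)
  then show "U \<subseteq> J" using unit_chain_mono[of j "length Us - 1"] unit_chain_last by auto
qed

text \<open>This is the bridge between the two sides: realizability of the members of a chain
  becomes a condition on the down-sets of its order.\<close>

lemma path_order_below:
  assumes "x \<in> J"
  shows "{y. (y, x) \<in> path_order Us} = Us ! entry_step Us x"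
proof -
  have l: "last Us = J" using chain by (simp add: unit_chain_def)
  have e: "entry_step Us x < length Us"
    using entry_step_le_card[OF assms] by (simp add: unit_chain_length)
  then have "Us ! entry_step Us x \<subseteq> J" by (intro unit_chain_subset) simp
  then show ?thesis
    using assms entry_step_le_iff[OF _ entry_step_le_card[OF assms]]
    by (auto simp: path_order_def l)
qed

lemma rank_path_order:
  assumes "x \<in> J"
  shows "rank (path_order Us) x = entry_step Us x"
  using unit_chain_nth entry_step_le_card[OF assms]
  by (simp add: rank_def path_order_below[OF assms] unit_chain_length)

lemma chain_of_path_order: "chain_of J (path_order Us) = Us"
proof (rule nth_equalityI)
  show "length (chain_of J (path_order Us)) = length Us" by (simp add: unit_chain_length)
  fix j assume "j < length (chain_of J (path_order Us))"
  then have j: "j \<le> card J" by simp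
  then have "Us ! j \<subseteq> J" by (intro unit_chain_subset) (simp add: unit_chain_length)
  then show "chain_of J (path_order Us) ! j = Us ! j"
    using j entry_step_le_iff[OF _ j] by (auto simp: rank_path_order)
qed

text \<open>Entry step 0 is impossible because the chain starts empty; a common entry step
  \<open>Suc j\<close> places both elements in the one-element difference of two consecutive
  members. This yields antisymmetry of the path order.\<close>

lemma entry_step_inj:
  assumes "x \<in> J" "y \<in> J" "entry_step Us x = entry_step Us y"
  shows "x = y"
proof (cases "entry_step Us x")
  case 0
  then have "x \<in> Us ! 0" using entry_step_le_iff[OF assms(1), of 0] by simp
  then show ?thesis using chain unfolding unit_chain_def by (metis empty_iff hd_conv_nth)
next
  case (Suc j)
  then have j: "Suc j \<le> card J" using entry_step_le_card[OF assms(1)] by simp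
  have "{x, y} \<subseteq> Us ! Suc j - Us ! j"
    using entry_step_le_iff[OF assms(1)] entry_step_le_iff[OF assms(2)] j Suc assms(3)
    by (metis Diff_iff Suc_leD Suc_n_not_le_n empty_subsetI insert_subset order_refl)
  moreover obtain z where "Us ! Suc j - Us ! j = {z}"
    using unit_chain_step[of j] j by (metis card_1_singletonE le_imp_less_Suc unit_chain_length)
  ultimately show ?thesis by auto
qed

lemma linear_order_on_path_order: "linear_order_on J (path_order Us)"
proof -
  have "last Us = J" using chain by (simp add: unit_chain_def)
  then show ?thesis
    using entry_step_inj
    unfolding order_on_defs refl_on_def trans_def antisym_def total_on_def path_order_def
    by (auto intro: order_trans)
qed

end

section \<open>Orders on a single packet and their initial segments\<close>

lemma Restr_eq_if_initial_in:
  assumes "linear_order_on J r" "P \<subseteq> J" "connex_on P L"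
    and init: "\<And>y. y \<in> P \<Longrightarrow> initial_in L (P \<inter> {x. (x, y) \<in> r}) P"
  shows "Restr r P = Restr L P"
proof -
  note lo = linear_order_on_facts[OF assms(1)]
  \<comment> \<open>By reflexivity \<open>y\<close> lies in its own down-set, which is
    \<open>L\<close>-initial in \<open>P\<close>; hence whatever is \<open>L\<close>-below
    \<open>y\<close> is \<open>r\<close>-below \<open>y\<close>. The converse follows from connexity
    of \<open>L\<close> and antisymmetry of \<open>r\<close>.\<close>
  have LR: "(x, y) \<in> r" if "(x, y) \<in> L" "x \<in> P" "y \<in> P" for x y
  proof -
    have "y \<in> P \<inter> {x. (x, y) \<in> r}" using lo(3) that(3) assms(2) by blast
    then show ?thesis using init[OF that(3)] that(1,2) unfolding initial_in_def by blast
  qed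
  have "(x, y) \<in> L" if "(x, y) \<in> r" "x \<in> P" "y \<in> P" for x y
  proof (rule ccontr)
    assume n: "(x, y) \<notin> L"
    then have "(y, x) \<in> L" using assms(3) that(2,3) by (auto simp: connex_on_def)
    then have "x = y" using LR[of y x] that lo(5) by blast
    with n \<open>(y, x) \<in> L\<close> show False by simp
  qed
  with LR show ?thesis by auto
qed

text \<open>Compare a point \<open>c\<close> of \<open>P\<close> outside \<open>J\<close> with a
  point \<open>b\<close> of \<open>P\<close> in \<open>U\<close>. If \<open>c\<close> is
  \<open>L\<close>-below \<open>b\<close>, initiality of \<open>P \<inter> J\<close> puts
  \<open>c\<close> into \<open>J\<close>; if it is above, the suffix property puts \<open>c\<close>
  into \<open>U\<close>, hence into \<open>J\<close>. So a suffix must be empty.\<close>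

lemma initial_in_partial:
  assumes "connex_on P L" "initial_in L (P \<inter> J) P" "P \<inter> J \<noteq> P" "U \<subseteq> J"
    and "initial_in L (P \<inter> U) P \<or> initial_in (L\<inverse>) (P \<inter> U) P"
  shows "initial_in L (P \<inter> U) P"
  using assms(5)
proof
  assume suf: "initial_in (L\<inverse>) (P \<inter> U) P"
  obtain c where c: "c \<in> P" "c \<notin> J" using assms(3) by blast
  have "P \<inter> U = {}"
  proof (rule ccontr)
    assume "P \<inter> U \<noteq> {}"
    then obtain b where b: "b \<in> P" "b \<in> U" by blast
    then have "(c, b) \<in> L \<or> (b, c) \<in> L" using assms(1) c(1) by (simp add: connex_on_def)
    moreover have "(c, b) \<notin> L" using assms(2,4) b c unfolding initial_in_def by blast
    moreover have "(b, c) \<notin> L" using suf assms(4) b c unfolding initial_in_def by blast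
    ultimately show False by blast
  qed
  then show ?thesis by (simp add: initial_in_def)
qed

lemma initial_in_mono: "initial_in L S P \<Longrightarrow> S \<subseteq> Q \<Longrightarrow> Q \<subseteq> P \<Longrightarrow> initial_in L S Q"
  unfolding initial_in_def by blast

text \<open>Used with \<open>lex_order\<close> for proper prefixes and with
  \<open>antilex_order\<close> for proper suffixes; in the second case the two alternatives of
  \<open>init\<close> are swapped.\<close>

lemma Restr_eq_if_partial:
  assumes "linear_order_on J r" "connex_on P L"
    and "initial_in L (P \<inter> J) P" "P \<inter> J \<noteq> P"
    and init: "\<And>y. y \<in> J \<Longrightarrow> initial_in L (P \<inter> {x. (x, y) \<in> r}) P \<or>
      initial_in (L\<inverse>) (P \<inter> {x. (x, y) \<in> r}) P"
  shows "Restr r (P \<inter> J) = Restr L (P \<inter> J)"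
proof (rule Restr_eq_if_initial_in[OF assms(1)])
  show "connex_on (P \<inter> J) L" using assms(2) by (rule connex_on_subset) simp
  fix y assume "y \<in> P \<inter> J"
  let ?U = "{x. (x, y) \<in> r}"
  have sub: "?U \<subseteq> J" using linear_order_on_facts(1)[OF assms(1)] by blast
  have "initial_in L (P \<inter> ?U) P"
    using initial_in_partial[OF assms(2-4) sub] init \<open>y \<in> P \<inter> J\<close> by blast
  then have "initial_in L (P \<inter> ?U) (P \<inter> J)" using sub by (auto intro: initial_in_mono)
  moreover have "P \<inter> J \<inter> ?U = P \<inter> ?U" using sub by blast
  ultimately show "initial_in L (P \<inter> J \<inter> ?U) (P \<inter> J)" by simp
qed simp

lemma Restr_eq_if_least:
  assumes r: "linear_order_on J r" "P \<subseteq> J" and con: "connex_on P L"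
    and m: "m \<in> P" "\<And>x. x \<in> P \<Longrightarrow> (m, x) \<in> r" "initial_in L {m} P"
    and init: "\<And>y. y \<in> P \<Longrightarrow> initial_in L (P \<inter> {x. (x, y) \<in> r}) P \<or>
      initial_in (L\<inverse>) (P \<inter> {x. (x, y) \<in> r}) P"
  shows "Restr r P = Restr L P"
proof (rule Restr_eq_if_initial_in[OF r con])
  fix y assume y: "y \<in> P"
  have "(m, b) \<in> L" if "b \<in> P" for b
    using con m(1,3) that unfolding connex_on_def initial_in_def by blast
  \<comment> \<open>A suffix that contains the \<open>L\<close>-least element \<open>m\<close> is
    all of \<open>P\<close>, and every down-set of a point of \<open>P\<close> contains
    \<open>m\<close>. Since \<open>P\<close> is also initial in itself, both alternatives of
    \<open>init\<close> give an initial segment.\<close>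
  then have "P \<inter> {x. (x, y) \<in> r} = P" if "initial_in (L\<inverse>) (P \<inter> {x. (x, y) \<in> r}) P"
    using that m(1) m(2)[OF y] unfolding initial_in_def by blast
  moreover have "initial_in L P P" by (simp add: initial_in_def)
  ultimately show "initial_in L (P \<inter> {x. (x, y) \<in> r}) P" using init[OF y] by metis
qed

lemma Restr_eq_if_full:
  assumes r: "linear_order_on J r" "P \<subseteq> J" and con: "connex_on P L" and "finite P"
    and init: "\<And>y. y \<in> P \<Longrightarrow> initial_in L (P \<inter> {x. (x, y) \<in> r}) P \<or>
      initial_in (L\<inverse>) (P \<inter> {x. (x, y) \<in> r}) P"
  shows "Restr r P = Restr L P \<or> Restr r P = Restr (L\<inverse>) P"
proof (cases "P = {}")
  case False
  note lo = linear_order_on_facts[OF r(1)]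
  \<comment> \<open>The first element of \<open>P\<close> to enter is its \<open>r\<close>-least
    element, which exists by finiteness.\<close>
  have "\<exists>m\<in>P. \<forall>x\<in>P. (m, x) \<in> r"
    using \<open>finite P\<close> False r(2)
  proof (induction P rule: finite_ne_induct)
    case (singleton x)
    then show ?case using lo(3) by simp
  next
    case (insert x F)
    then obtain m where m: "m \<in> F" "\<forall>y\<in>F. (m, y) \<in> r" by auto
    have "x \<in> J" "m \<in> J" using insert.prems m(1) by auto
    then consider "(m, x) \<in> r" | "(x, m) \<in> r" using lo(6) by blast
    then show ?case
    proof cases
      case 1
      then show ?thesis using m by blast
    next
      case 2
      then have "\<forall>y\<in>insert x F. (x, y) \<in> r"
        using m(2) lo(4) lo(3)[OF \<open>x \<in> J\<close>] by blast
      then show ?thesis by blast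
    qed
  qed
  then obtain m where m: "m \<in> P" "\<And>x. x \<in> P \<Longrightarrow> (m, x) \<in> r" by blast
  \<comment> \<open>The singleton is a segment at one end of \<open>P\<close>, and which end it is
    decides between \<open>L\<close> and its converse.\<close>
  have "P \<inter> {x. (x, m) \<in> r} = {m}" using m lo(3,5) r(2) by blast
  with init[OF m(1)] have "initial_in L {m} P \<or> initial_in (L\<inverse>) {m} P" by simp
  then show ?thesis
  proof
    assume "initial_in L {m} P"
    then show ?thesis using Restr_eq_if_least[OF r con m] init by simp
  next
    assume "initial_in (L\<inverse>) {m} P"
    then have "Restr r P = Restr (L\<inverse>) P"
      using r con m init by (intro Restr_eq_if_least[where m = m]) auto
    then show ?thesis ..
  qed
qed simp

text \<open>A point of \<open>P\<close> that is \<open>L\<close>-below a point of \<open>U\<close>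
  lies in \<open>J\<close>, because \<open>P \<inter> J\<close> is initial. There \<open>r\<close>
  and \<open>L\<close> agree, so it is also \<open>r\<close>-below, and down-closure of
  \<open>U\<close> under \<open>r\<close> applies.\<close>

lemma initial_in_if_Restr_eq:
  assumes "Restr r (P \<inter> J) = Restr L (P \<inter> J)" "initial_in L (P \<inter> J) P" "U \<subseteq> J"
    and "\<And>x y. (x, y) \<in> r \<Longrightarrow> y \<in> U \<Longrightarrow> x \<in> U"
  shows "initial_in L (P \<inter> U) P"
  unfolding initial_in_def
proof (intro conjI ballI impI)
  fix b a assume "b \<in> P \<inter> U" "a \<in> P" "(a, b) \<in> L"
  moreover from this have "a \<in> P \<inter> J" using assms(2,3) unfolding initial_in_def by blast
  ultimately have "(a, b) \<in> Restr r (P \<inter> J)" using assms(1,3) by auto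
  then show "a \<in> P \<inter> U" using assms(4) \<open>b \<in> P \<inter> U\<close> by blast
qed simp

section \<open>Paths and admissible orders\<close>

lemma bruhat_paths_iff:
  "Us \<in> bruhat_paths n k J \<longleftrightarrow> unit_chain J Us \<and> (\<forall>U \<in> set Us. realizable n k U)"
  by (auto simp: bruhat_paths_def unit_chain_def)

lemma realizable_iff_initial_in:
  "realizable n k A \<longleftrightarrow> A \<subseteq> ksubsets n k \<and>
     (\<forall>X \<in> ksubsets n (k + 1). initial_in lex_order (packet n k X \<inter> A) (packet n k X) \<or>
        initial_in antilex_order (packet n k X \<inter> A) (packet n k X))"
  by (simp add: realizable_def lex_prefix_iff_initial_in lex_suffix_iff_initial_in)

lemma path_order_admissible:
  assumes "Us \<in> bruhat_paths n k J"
  shows "path_order Us \<in> admissible_orders n k J"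
proof -
  have chain: "unit_chain J Us" and real: "\<And>U. U \<in> set Us \<Longrightarrow> realizable n k U"
    using assms by (auto simp: bruhat_paths_iff)
  note lin = linear_order_on_path_order[OF chain]
  \<comment> \<open>Each principal down-set of the path order is a member of the path, hence
    realizable.\<close>
  have below: "initial_in lex_order (packet n k X \<inter> {x. (x, y) \<in> path_order Us}) (packet n k X) \<or>
      initial_in antilex_order (packet n k X \<inter> {x. (x, y) \<in> path_order Us}) (packet n k X)"
    if "X \<in> ksubsets n (k + 1)" "y \<in> J" for X y
  proof -
    have "Us ! entry_step Us y \<in> set Us"
      using entry_step_le_card[OF chain that(2)] unit_chain_length[OF chain] by simp
    then show ?thesis
      using real that path_order_below[OF chain] by (simp add: realizable_iff_initial_in)
  qed
  show ?thesis
    unfolding admissible_orders_def mem_Collect_eq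
  proof (intro conjI ballI)
    show "linear_order_on J (path_order Us)" by (rule lin)
    fix X
    show "Restr (path_order Us) (packet n k X \<inter> J) = Restr antilex_order (packet n k X \<inter> J)"
      if "X \<in> suffix_part n k J"
      using that below packet_lex_connex_on
      by (intro Restr_eq_if_partial[OF lin])
        (auto simp: suffix_part_def lex_suffix_iff_initial_in)
    show "Restr (path_order Us) (packet n k X \<inter> J) = Restr lex_order (packet n k X \<inter> J)"
      if "X \<in> prefix_part n k J"
      using that below packet_lex_connex_on
      by (intro Restr_eq_if_partial[OF lin])
        (auto simp: prefix_part_def lex_prefix_iff_initial_in)
    show "Restr (path_order Us) (packet n k X) = Restr lex_order (packet n k X) \<or>
        Restr (path_order Us) (packet n k X) = Restr antilex_order (packet n k X)"
      if "X \<in> full_part n k J"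
    proof (rule Restr_eq_if_full[OF lin])
      show "finite (packet n k X)"
        by (rule finite_subset[OF _ finite_ksubsets]) (auto simp: packet_def)
      show "packet n k X \<subseteq> J" using that by (simp add: full_part_def)
      then show "initial_in lex_order (packet n k X \<inter> {x. (x, y) \<in> path_order Us}) (packet n k X) \<or>
          initial_in antilex_order (packet n k X \<inter> {x. (x, y) \<in> path_order Us}) (packet n k X)"
        if "y \<in> packet n k X" for y
        using that \<open>X \<in> full_part n k J\<close> below by (auto simp: full_part_def)
    qed (rule packet_lex_connex_on)
  qed
qed

lemma realizable_if_down_closed:
  assumes "realizable n k J" "r \<in> admissible_orders n k J" "U \<subseteq> J"
    and down: "\<And>x y. (x, y) \<in> r \<Longrightarrow> y \<in> U \<Longrightarrow> x \<in> U"
  shows "realizable n k U"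
  unfolding realizable_iff_initial_in
proof (intro conjI ballI)
  show "U \<subseteq> ksubsets n k" using assms(1,3) by (auto simp: realizable_def)
  fix X assume X: "X \<in> ksubsets n (k + 1)"
  let ?P = "packet n k X"
  let ?goal = "initial_in lex_order (?P \<inter> U) ?P \<or> initial_in antilex_order (?P \<inter> U) ?P"
  have J: "initial_in lex_order (?P \<inter> J) ?P \<or> initial_in antilex_order (?P \<inter> J) ?P"
    using assms(1) X by (simp add: realizable_iff_initial_in)
  have initial: "initial_in L (?P \<inter> U) ?P"
    if "Restr r (?P \<inter> J) = Restr L (?P \<inter> J)" "initial_in L (?P \<inter> J) ?P" for L
    using that assms(3) down by (rule initial_in_if_Restr_eq)
  \<comment> \<open>Apart from the empty intersection, the cases match the three clauses of
    admissibility: full, proper prefix, proper suffix.\<close>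
  consider "?P \<inter> J = {}" | "?P \<inter> J = ?P"
    | "?P \<inter> J \<noteq> {}" "?P \<inter> J \<noteq> ?P" "initial_in lex_order (?P \<inter> J) ?P"
    | "?P \<inter> J \<noteq> {}" "?P \<inter> J \<noteq> ?P" "initial_in antilex_order (?P \<inter> J) ?P"
    using J by blast
  then show ?goal
  proof cases
    case 1
    then have "?P \<inter> U = {}" using assms(3) by blast
    then show ?thesis by (simp add: initial_in_def)
  next
    case 2
    then have "X \<in> full_part n k J" using X by (auto simp: full_part_def)
    then have "Restr r (?P \<inter> J) = Restr lex_order (?P \<inter> J) \<or>
        Restr r (?P \<inter> J) = Restr antilex_order (?P \<inter> J)"
      using assms(2) 2 by (auto simp: admissible_orders_def)
    \<comment> \<open>A whole packet is initial for both orders, so either alternative allowed on a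
      full packet suffices.\<close>
    moreover have all: "initial_in L (?P \<inter> J) ?P" for L using 2 by (simp add: initial_in_def)
    ultimately show ?thesis using initial[OF _ all] by (elim disjE) simp_all
  next
    case 3
    then have "X \<in> prefix_part n k J"
      using X by (simp add: prefix_part_def lex_prefix_iff_initial_in)
    then show ?thesis using initial[OF _ 3(3)] assms(2) by (simp add: admissible_orders_def)
  next
    case 4
    then have "X \<in> suffix_part n k J"
      using X by (simp add: suffix_part_def lex_suffix_iff_initial_in)
    then show ?thesis using initial[OF _ 4(3)] assms(2) by (simp add: admissible_orders_def)
  qed
qed

lemma chain_of_bruhat_path:
  assumes "realizable n k J" "finite J" "r \<in> admissible_orders n k J"
  shows "chain_of J r \<in> bruhat_paths n k J"
  unfolding bruhat_paths_iff
proof (intro conjI ballI)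
  have lin: "linear_order_on J r" using assms(3) by (simp add: admissible_orders_def)
  note lo = linear_order_on_facts[OF lin]
  show "unit_chain J (chain_of J r)" by (rule unit_chain_chain_of[OF assms(2) lin])
  fix U assume "U \<in> set (chain_of J r)"
  then obtain j where U: "U = {x \<in> J. rank r x \<le> j}" by (auto simp: chain_of_def)
  show "realizable n k U"
  proof (rule realizable_if_down_closed[OF assms(1,3)])
    show "U \<subseteq> J" using U by blast
    \<comment> \<open>Bounding the rank gives a set that is down-closed under \<open>r\<close>,
      because ranks are monotone.\<close>
    show "x \<in> U" if "(x, y) \<in> r" "y \<in> U" for x y
      using that U lo(1)[OF that(1)] rank_le_iff[OF assms(2) lin, of x y] by auto
  qed
qed

theorem theorem3p19:
  fixes n k :: nat and J :: "nat set set"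
  assumes "k > 1" and "realizable n k J"
  shows "bij_betw path_order (bruhat_paths n k J) (admissible_orders n k J)"
proof (rule bij_betw_byWitness[where f' = "chain_of J"])
  have fin: "finite J"
    using assms(2) finite_subset[OF _ finite_ksubsets] by (auto simp: realizable_def)
  \<comment> \<open>The two inverse laws come from unit chains and linear orders in general; the
    packet conditions enter through the two inclusions.\<close>
  show "\<forall>Us \<in> bruhat_paths n k J. chain_of J (path_order Us) = Us"
    using chain_of_path_order by (auto simp: bruhat_paths_iff)
  show "\<forall>r \<in> admissible_orders n k J. path_order (chain_of J r) = r"
    using path_order_chain_of[OF fin] by (auto simp: admissible_orders_def)
  show "path_order ` bruhat_paths n k J \<subseteq> admissible_orders n k J"
    using path_order_admissible by blast
  show "chain_of J ` admissible_orders n k J \<subseteq> bruhat_paths n k J"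
    using chain_of_bruhat_path[OF assms(2) fin] by blast
qed

end
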